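(* Let $d\ge 2$, let $\mu$ be a probability measure on $\mathcal{P}$, and let $(X_n)_{n\ge 0}$ be the random walk in i.i.d. random environment determined by $\mu$, with annealed law $P$. If there exists a nonempty orthogonal set $V\subset \mathcal{E}$ such that $\mu(\mathcal{G}_o\cap V\neq\varnothing)=1$, then the random walk visits infinitely many sites, $P$-almost surely. Otherwise (if no such $V$ exists) the random walk visits only finitely many sites, $P$-almost surely.
   Context: $\mathcal{E}=\{\pm e_i: i=1,\dots,d\}$ is the set of unit vectors in $\mathbb{Z}^d$ and $o$ is the origin. $\mathcal{P}$ is the set of probability measures on $\mathcal{E}$, and $\mu$ is a probability measure on $\mathcal{P}$. $\Omega=\mathcal{P}^{\mathbb{Z}^d}$ carries the product measure $\nu=\mu^{\otimes\mathbb{Z}^d}$; an environment is $\omega=(\omega_x)_{x\in\mathbb{Z}^d}\in\Omega$ (so the $\omega_x$ are i.i.d. with law $\mu$ under $\nu$), and $\omega_x(e)$ means $\omega_x(\{e\})$. Given $\omega$, $\mathbb{P}_\omega$ is the law of the time-homogeneous Markov chain $(X_n)_{n\ge0}$ on $\mathbb{Z}^d$ with $X_0=o$ and transition probability $\omega_x(e)$ from $x$ to $x+e$, $e\in\mathcal{E}$. The annealed law is $P(\cdot)=\int \mathbb{P}_\omega(\cdot)\,d\nu(\omega)$. No ellipticity is assumed: $\omega_x(e)$ may vanish. For $x\in\mathbb{Z}^d$, $\mathcal{G}_x=\mathcal{G}_x(\omega)=\{e\in\mathcal{E}:\omega_x(e)>0\}$ (always nonempty); since $\mathcal{G}_o$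 is a function of $\omega_o$, which has law $\mu$, probabilities of events concerning $\mathcal{G}_o$ are written with $\mu$. A set $V\subset\mathcal{E}$ is orthogonal if $u\cdot v=0$ for all distinct $u,v\in V$. *)

theory Defs
  imports "HOL-Probability.Probability"
begin

section \<open>Unit vectors and environments\<close>

text \<open>The lattice is \<^typ>\<open>int ^ 'd\<close>; its dimension is \<open>CARD('d)\<close>.\<close>

definition unit_vectors :: "(int ^ 'd) set" where
  "unit_vectors = (\<Union>i. {axis i 1, - axis i 1})"

definition int_dot :: "int ^ 'd \<Rightarrow> int ^ 'd \<Rightarrow> int" where
  "int_dot u v = (\<Sum>i\<in>UNIV. u $ i * v $ i)"

definition orthogonal_set :: "(int ^ 'd) set \<Rightarrow> bool" where
  "orthogonal_set V \<longleftrightarrow> (\<forall>u\<in>V. \<forall>v\<in>V. u \<noteq> v \<longrightarrow> int_dot u v = 0)"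

text \<open>
  The set of probability measures on the unit vectors, with the \<open>\<sigma>\<close>-algebra generated by the
  evaluations \<open>p \<mapsto> p A\<close>.
\<close>
definition step_laws :: "(int ^ 'd) measure measure" where
  "step_laws = prob_algebra (count_space unit_vectors)"

definition env_law :: "(int ^ 'd) measure measure \<Rightarrow> (int ^ 'd \<Rightarrow> (int ^ 'd) measure) measure" where
  "env_law \<mu> = (\<Pi>\<^sub>M x\<in>UNIV. \<mu>)"

text \<open>
  For an environment \<open>\<omega>\<close>, the random set \<open>\<G>\<^sub>x\<close> is \<open>allowed_steps (\<omega> x)\<close>.
\<close>
definition allowed_steps :: "(int ^ 'd) measure \<Rightarrow> (int ^ 'd) set" where
  "allowed_steps p = {e \<in> unit_vectors. measure p {e} > 0}"


section \<open>Quenched and annealed laws\<close>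

definition path_space :: "(nat \<Rightarrow> int ^ 'd) measure" where
  "path_space = (\<Pi>\<^sub>M n\<in>UNIV. count_space UNIV)"

text \<open>The conditional law of \<open>X\<^sub>n\<close> given the positions \<open>x 0, \<dots>, x (n - 1)\<close>.\<close>
definition walk_kernel ::
    "(int ^ 'd \<Rightarrow> (int ^ 'd) measure) \<Rightarrow> nat \<Rightarrow> (nat \<Rightarrow> int ^ 'd) \<Rightarrow> (int ^ 'd) measure" where
  "walk_kernel \<omega> n x =
     (if n = 0 then return (count_space UNIV) 0
      else distr (\<omega> (x (n - 1))) (count_space UNIV) (\<lambda>e. x (n - 1) + e))"

text \<open>
  The Ionescu-Tulcea measure of these kernels. The lemma \<open>emeasure_quenched_law_cylinder\<close> below
  says that under it the coordinate process is the required Markov chain started at the origin.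
\<close>
definition quenched_law :: "(int ^ 'd \<Rightarrow> (int ^ 'd) measure) \<Rightarrow> (nat \<Rightarrow> int ^ 'd) measure" where
  "quenched_law \<omega> =
     projective_family.lim UNIV
       (Ionescu_Tulcea.CI (walk_kernel \<omega>) (\<lambda>_. count_space UNIV)) (\<lambda>_. count_space UNIV)"

definition annealed_law :: "(int ^ 'd) measure measure \<Rightarrow> (nat \<Rightarrow> int ^ 'd) measure" where
  "annealed_law \<mu> = env_law \<mu> \<bind> quenched_law"


section \<open>Well-definedness of the laws\<close>

lemma space_step_laws:
  "p \<in> space (step_laws :: (int ^ 'd) measure measure) \<longleftrightarrow>
     prob_space p \<and> sets p = Pow unit_vectors"
  by (auto simp: step_laws_def space_prob_algebra)

context
  fixes \<omega> :: "int ^ 'd \<Rightarrow> (int ^ 'd) measure"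
  assumes \<omega>: "\<And>x. \<omega> x \<in> space step_laws"
begin

lemma walk_kernel_prob: "walk_kernel \<omega> n x \<in> space (prob_algebra (count_space UNIV))"
proof -
  have "prob_space (\<omega> y)" for y
    using \<omega> by (simp add: space_step_laws)
  moreover have "(\<lambda>e. y + e) \<in> \<omega> y \<rightarrow>\<^sub>M count_space UNIV" for y
    using \<omega>[of y] by (auto simp: space_step_laws measurable_def)
  ultimately show ?thesis
    by (auto simp: walk_kernel_def space_prob_algebra
        intro!: prob_space_return prob_space.prob_space_distr)
qed

lemma Ionescu_Tulcea_walk: "Ionescu_Tulcea (walk_kernel \<omega>) (\<lambda>_. count_space UNIV)"
proof (rule Ionescu_Tulcea.intro)
  fix n
  let ?N = "count_space UNIV :: (int ^ 'd) measure"
  show "walk_kernel \<omega> n \<in> PiM {0..<n} (\<lambda>_. ?N) \<rightarrow>\<^sub>M subprob_algebra ?N"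
  proof (cases n)
    case 0
    have "walk_kernel \<omega> n = (\<lambda>x. return ?N 0)"
      by (auto simp: walk_kernel_def 0)
    then show ?thesis
      by (auto simp: space_subprob_algebra intro!: measurable_const prob_space_return
          prob_space_imp_subprob_space)
  next
    case (Suc m)
    have eq: "walk_kernel \<omega> n = (\<lambda>y. walk_kernel \<omega> n (\<lambda>_. y)) \<circ> (\<lambda>x. x m)"
      by (auto simp: walk_kernel_def Suc fun_eq_iff)
    have "(\<lambda>y. walk_kernel \<omega> n (\<lambda>_. y)) \<in> ?N \<rightarrow>\<^sub>M subprob_algebra ?N"
      using walk_kernel_prob
      by (auto simp: space_prob_algebra space_subprob_algebra intro!: prob_space_imp_subprob_space)
    then show ?thesis
      by (subst eq, intro measurable_comp[where N = ?N] measurable_component_singleton)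
        (auto simp: Suc)
  qed
next
  fix n x
  show "prob_space (walk_kernel \<omega> n x)"
    using walk_kernel_prob by (simp add: space_prob_algebra)
qed

interpretation IT: Ionescu_Tulcea "walk_kernel \<omega>" "\<lambda>_. count_space UNIV"
  by (rule Ionescu_Tulcea_walk)

lemma emeasure_C_singleton:
  "emeasure (IT.C 0 n (\<lambda>_. undefined)) {restrict x {0..<n}} =
     (\<Prod>i<n. emeasure (walk_kernel \<omega> i x) {x i})"
proof (induction n)
  case 0
  have "{restrict x {0..<0}} \<in> sets (PiM {0..<0} (\<lambda>_. count_space UNIV :: (int ^ 'd) measure))"
    by (auto simp: PiM_empty restrict_def)
  then show ?case
    by (simp add: restrict_def)
next
  case (Suc n)
  let ?M = "\<lambda>n. PiM {0..<n} (\<lambda>_. count_space UNIV :: (int ^ 'd) measure)"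
  have s: "{restrict x {0..<n}} \<in> sets (?M n)" for n
  proof -
    have "(\<Pi>\<^sub>E i\<in>{0..<n}. {x i}) \<in> sets (?M n)"
      by (intro sets_PiM_I_finite) auto
    moreover have "(\<Pi>\<^sub>E i\<in>{0..<n}. {x i}) = {restrict x {0..<n}}"
      by (auto simp: PiE_iff fun_eq_iff extensional_def restrict_def; metis)
    ultimately show ?thesis by simp
  qed
  have eP: "emeasure (IT.eP n y) {restrict x {0..<Suc n}} =
      emeasure (walk_kernel \<omega> n x) {x n} * indicator {restrict x {0..<n}} y"
    if y: "y \<in> space (?M n)" for y
  proof -
    have "emeasure (IT.eP n y) {restrict x {0..<Suc n}} =
        emeasure (walk_kernel \<omega> n y) ((\<lambda>z. y(n := z)) -` {restrict x {0..<Suc n}})"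
      using IT.emeasure_eP[OF y s[of "Suc n"]] by simp
    also have "\<dots> = emeasure (walk_kernel \<omega> n x) {x n} * indicator {restrict x {0..<n}} y"
    proof (cases "y = restrict x {0..<n}")
      case True
      have "(\<lambda>z. y(n := z)) -` {restrict x {0..<Suc n}} = {x n}"
        by (auto simp: True fun_eq_iff restrict_def split: if_splits)
      moreover have "walk_kernel \<omega> n y = walk_kernel \<omega> n x"
        by (auto simp: walk_kernel_def True)
      ultimately show ?thesis
        using True by simp
    next
      case False
      have "y = restrict x {0..<n}" if "y(n := z) = restrict x {0..<Suc n}" for z
      proof
        fix i
        have "y i = undefined" if "i \<ge> n"
          using y that by (auto simp: space_PiM PiE_iff extensional_def)
        moreover have "(y(n := z)) i = restrict x {0..<Suc n} i"
          using that by simp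
        ultimately show "y i = restrict x {0..<n} i"
          by (auto simp: restrict_def split: if_splits)
      qed
      then have "(\<lambda>z. y(n := z)) -` {restrict x {0..<Suc n}} = {}"
        using False by auto
      then show ?thesis
        using False by simp
    qed
    finally show ?thesis .
  qed
  have u: "(\<lambda>_. undefined) \<in> space (?M 0)"
    by (simp add: space_PiM PiE_iff extensional_def)
  have sp: "space (IT.C 0 n (\<lambda>_. undefined)) = space (?M n)"
    using IT.space_C[OF u, of n] by simp
  have st: "sets (IT.C 0 n (\<lambda>_. undefined)) = sets (?M n)"
    using IT.sets_C[OF u, of n] by simp
  have "emeasure (IT.C 0 (Suc n) (\<lambda>_. undefined)) {restrict x {0..<Suc n}} =
      (\<integral>\<^sup>+y. emeasure (IT.eP n y) {restrict x {0..<Suc n}} \<partial>IT.C 0 n (\<lambda>_. undefined))"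
    using IT.measurable_eP[of n] s[of "Suc n"] prob_space.not_empty[OF IT.prob_space_C[OF u]]
    by (auto simp: measurable_cong_sets[OF st refl]
        intro!: emeasure_bind[where N = "?M (Suc n)"])
  also have "\<dots> = (\<integral>\<^sup>+y. emeasure (walk_kernel \<omega> n x) {x n} * indicator {restrict x {0..<n}} y
      \<partial>IT.C 0 n (\<lambda>_. undefined))"
    by (intro nn_integral_cong eP) (simp add: sp)
  also have "\<dots> = emeasure (walk_kernel \<omega> n x) {x n} *
      emeasure (IT.C 0 n (\<lambda>_. undefined)) {restrict x {0..<n}}"
    using s[of n] by (intro nn_integral_cmult_indicator) (simp add: st)
  finally show ?case
    unfolding prod.lessThan_Suc Suc by (simp only: mult.commute)
qed

lemma emeasure_quenched_law_prefix:
  "emeasure (quenched_law \<omega>) {X. \<forall>i<n. X i = x i} =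
     (\<Prod>i<n. emeasure (walk_kernel \<omega> i x) {x i})"
proof -
  let ?N = "count_space UNIV :: (int ^ 'd) measure"
  have eq: "(\<Pi>\<^sub>E i\<in>{0..<n}. {x i}) = {restrict x {0..<n}}"
    by (auto simp: PiE_iff fun_eq_iff extensional_def restrict_def; metis)
  have s: "(\<Pi>\<^sub>E i\<in>{0..<n}. {x i}) \<in> sets (PiM {0..<n} (\<lambda>_. ?N))"
    by (intro sets_PiM_I_finite) auto
  have "{X. \<forall>i<n. X i = x i} = prod_emb UNIV (\<lambda>_. ?N) {0..<n} (\<Pi>\<^sub>E i\<in>{0..<n}. {x i})"
    by (auto simp: prod_emb_def PiE_iff restrict_def extensional_def split: if_splits)
  then have "emeasure (quenched_law \<omega>) {X. \<forall>i<n. X i = x i} =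
      emeasure (IT.CI {0..<n}) (\<Pi>\<^sub>E i\<in>{0..<n}. {x i})"
    using IT.lim[OF _ s] by (simp add: quenched_law_def)
  also have "\<dots> = emeasure (IT.C 0 n (\<lambda>_. undefined)) (\<Pi>\<^sub>E i\<in>{0..<n}. {x i})"
    using IT.emeasure_CI[OF subset_refl s] sets.sets_into_space[OF s]
    by (simp add: prod_emb_id space_PiM)
  finally show ?thesis
    by (simp add: eq emeasure_C_singleton)
qed

lemma sets_quenched_law: "sets (quenched_law \<omega>) = sets path_space"
  by (simp add: quenched_law_def path_space_def)

lemma prob_space_quenched_law: "prob_space (quenched_law \<omega>)"
proof
  have "space (quenched_law \<omega>) = UNIV"
    using sets_eq_imp_space_eq[OF sets_quenched_law] by (simp add: path_space_def space_PiM)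
  then show "emeasure (quenched_law \<omega>) (space (quenched_law \<omega>)) = 1"
    using emeasure_quenched_law_prefix[where n = 0] by simp
qed

lemma emeasure_quenched_law_cylinder:
  "emeasure (quenched_law \<omega>) {X. \<forall>i\<le>n. X i = x i} =
     (if x 0 = 0 then \<Prod>i<n. emeasure (\<omega> (x i)) {x (Suc i) - x i} else 0)"
proof -
  have step: "emeasure (walk_kernel \<omega> (Suc i) x) {x (Suc i)} =
      emeasure (\<omega> (x i)) {x (Suc i) - x i}" for i
  proof -
    have sets: "sets (\<omega> (x i)) = Pow unit_vectors"
      using \<omega> by (simp add: space_step_laws)
    then have space: "space (\<omega> (x i)) = unit_vectors"
      using sets_eq_imp_space_eq[of "\<omega> (x i)" "count_space unit_vectors"] by simp
    have "emeasure (walk_kernel \<omega> (Suc i) x) {x (Suc i)} =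
        emeasure (\<omega> (x i)) ((\<lambda>e. x i + e) -` {x (Suc i)} \<inter> unit_vectors)"
      by (auto simp: walk_kernel_def emeasure_distr space measurable_def sets)
    also have "(\<lambda>e. x i + e) -` {x (Suc i)} = {x (Suc i) - x i}"
      by (auto simp: algebra_simps)
    also have "emeasure (\<omega> (x i)) ({x (Suc i) - x i} \<inter> unit_vectors) =
        emeasure (\<omega> (x i)) {x (Suc i) - x i}"
      by (cases "x (Suc i) - x i \<in> unit_vectors") (auto simp: emeasure_notin_sets sets)
    finally show ?thesis .
  qed
  have "{X. \<forall>i\<le>n. X i = x i} = {X. \<forall>i<Suc n. X i = x i}"
    by (simp add: less_Suc_eq_le)
  then have "emeasure (quenched_law \<omega>) {X. \<forall>i\<le>n. X i = x i} =
      (\<Prod>i<Suc n. emeasure (walk_kernel \<omega> i x) {x i})"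
    by (simp only: emeasure_quenched_law_prefix)
  also have "\<dots> = emeasure (walk_kernel \<omega> 0 x) {x 0} *
      (\<Prod>i<n. emeasure (\<omega> (x i)) {x (Suc i) - x i})"
    by (simp only: prod.lessThan_Suc_shift step)
  also have "emeasure (walk_kernel \<omega> 0 x) {x 0} = (if x 0 = 0 then 1 else 0)"
    by (auto simp: walk_kernel_def)
  finally show ?thesis
    by simp
qed

end

text \<open>
  The map \<open>\<omega> \<mapsto> quenched_law \<omega>\<close> is a probability kernel, so the monadic bind in
  \<^const>\<open>annealed_law\<close> is the mixture of the quenched laws.
\<close>
lemma measurable_quenched_law:
  assumes \<mu>: "sets \<mu> = sets (step_laws :: (int ^ 'd) measure measure)"
  shows "quenched_law \<in> env_law \<mu> \<rightarrow>\<^sub>M prob_algebra path_space"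
proof -
  define cyl :: "(int ^ 'd) list \<Rightarrow> (nat \<Rightarrow> int ^ 'd) set"
    where "cyl = (\<lambda>xs. {X. \<forall>i<length xs. X i = xs ! i})"
  define G where "G = insert {} (range cyl)"
  have "countable G"
    by (simp add: G_def)
  have space_env: "\<omega> x \<in> space step_laws" if "\<omega> \<in> space (env_law \<mu>)" for \<omega> x
    using that sets_eq_imp_space_eq[OF \<mu>] by (auto simp: env_law_def space_PiM PiE_iff)
  have cyl_prefix: "cyl (map X [0..<n]) = {Y. \<forall>i<n. Y i = X i}" for X n
    by (auto simp: cyl_def)
  have cyl_meas: "cyl xs \<in> sets path_space" for xs
  proof -
    have "(\<lambda>X. X i) -` {c} \<inter> space path_space \<in> sets path_space"
      for i and c :: "int ^ 'd"
      unfolding path_space_def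
      by (rule measurable_sets[OF measurable_component_singleton]) auto
    then have "{X \<in> space path_space. X i = c} \<in> sets path_space" for i and c :: "int ^ 'd"
      by (simp add: vimage_def Int_def conj_commute)
    then have "{X \<in> space path_space. \<forall>i\<in>{..<length xs}. X i = xs ! i} \<in> sets path_space"
      by (intro sets.sets_Collect_finite_All) auto
    moreover have "cyl xs = {X \<in> space path_space. \<forall>i\<in>{..<length xs}. X i = xs ! i}"
      by (auto simp: cyl_def path_space_def space_PiM)
    ultimately show ?thesis by simp
  qed
  have "sets path_space = sigma_sets UNIV G"
  proof (intro antisym)
    show "sigma_sets UNIV G \<subseteq> sets path_space"
      using sets.sigma_sets_subset[of G path_space] cyl_meas
      by (auto simp: G_def path_space_def space_PiM)
    have single: "{X. X i \<in> A} \<in> sigma_sets UNIV G" for i and A :: "(int ^ 'd) set"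
    proof -
      have "{X. X i \<in> A} = \<Union>{c \<in> G. c \<subseteq> {X. X i \<in> A}}"
      proof (intro antisym subsetI)
        fix X assume "X \<in> {X. X i \<in> A}"
        then have "cyl (map X [0..<Suc i]) \<subseteq> {X. X i \<in> A}"
          by (auto simp only: cyl_prefix)
        moreover have "X \<in> cyl (map X [0..<Suc i])"
          by (auto simp only: cyl_prefix)
        ultimately show "X \<in> \<Union>{c \<in> G. c \<subseteq> {X. X i \<in> A}}"
          by (auto simp: G_def)
      qed auto
      moreover have "\<Union>{c \<in> G. c \<subseteq> {X. X i \<in> A}} \<in> sigma_sets UNIV G"
      proof -
        interpret sigma_algebra UNIV "sigma_sets UNIV G"
          by (rule sigma_algebra_sigma_sets) auto
        show ?thesis
          using \<open>countable G\<close> by (intro countable_Union) (auto intro: countable_subset)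
      qed
      ultimately show ?thesis by simp
    qed
    show "sets path_space \<subseteq> sigma_sets UNIV G"
      unfolding path_space_def sets_PiM_single
      using single by (auto simp: PiE_UNIV_domain intro!: sigma_sets_mono)
  qed
  moreover have "Int_stable G"
  proof (rule Int_stableI)
    have *: "cyl xs \<inter> cyl ys \<in> G" if "length xs \<le> length ys" for xs ys
    proof (cases "cyl xs \<inter> cyl ys = {}")
      case False
      then obtain X where "X \<in> cyl xs" "X \<in> cyl ys" by auto
      then have "cyl ys \<subseteq> cyl xs"
        using that by (fastforce simp: cyl_def)
      then have "cyl xs \<inter> cyl ys = cyl ys" by auto
      then show ?thesis by (simp add: G_def)
    qed (simp add: G_def)
    fix a b assume "a \<in> G" "b \<in> G"
    then show "a \<inter> b \<in> G"
    proof (cases "a = {} \<or> b = {}")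
      case True
      then show ?thesis by (auto simp: G_def)
    next
      case False
      with \<open>a \<in> G\<close> \<open>b \<in> G\<close> obtain xs ys where ab: "a = cyl xs" "b = cyl ys"
        by (auto simp: G_def)
      show ?thesis
        using *[of xs ys] *[of ys xs] nat_le_linear[of "length xs" "length ys"]
        by (auto simp: ab Int_commute)
    qed
  qed
  moreover have "(\<lambda>\<omega>. emeasure (quenched_law \<omega>) c) \<in> borel_measurable (env_law \<mu>)" if "c \<in> G" for c
  proof (cases "c = {}")
    case False
    with that obtain xs where c: "c = cyl xs" by (auto simp: G_def)
    show ?thesis
    proof (cases "length xs")
      case 0
      have "emeasure (quenched_law \<omega>) c = 1" if "\<omega> \<in> space (env_law \<mu>)" for \<omega>
        using emeasure_quenched_law_prefix[OF space_env[OF that], where n = 0] by (simp add: c cyl_def 0)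
      then show ?thesis
        by (simp cong: measurable_cong)
    next
      case (Suc n)
      have eq: "c = {X. \<forall>i\<le>n. X i = xs ! i}"
        by (simp add: c cyl_def Suc less_Suc_eq_le)
      have "emeasure (quenched_law \<omega>) c =
          (if xs ! 0 = 0 then \<Prod>i<n. emeasure (\<omega> (xs ! i)) {xs ! Suc i - xs ! i} else 0)"
        if "\<omega> \<in> space (env_law \<mu>)" for \<omega>
        using emeasure_quenched_law_cylinder[OF space_env[OF that]] by (simp add: eq)
      moreover have "(\<lambda>\<omega>. emeasure (\<omega> y) {e}) \<in> borel_measurable (env_law \<mu>)" for y e
      proof (cases "e \<in> unit_vectors")
        case True
        have "(\<lambda>p. emeasure p {e}) \<in> borel_measurable step_laws"
          using True by (auto simp: step_laws_def prob_algebra_def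
              intro!: measurable_restrict_space1 measurable_emeasure_subprob_algebra)
        then have "(\<lambda>p. emeasure p {e}) \<in> borel_measurable \<mu>"
          by (simp cong: measurable_cong_sets add: \<mu>)
        then show ?thesis
          unfolding env_law_def by (rule measurable_compose[rotated]) auto
      next
        case False
        have "emeasure (\<omega> y) {e} = 0" if "\<omega> \<in> space (env_law \<mu>)" for \<omega>
          using space_env[OF that, of y] False
          by (intro emeasure_notin_sets) (auto simp: space_step_laws)
        then show ?thesis
          by (simp cong: measurable_cong)
      qed
      ultimately show ?thesis
        by (simp cong: measurable_cong)
    qed
  qed simp
  moreover have "prob_space (quenched_law \<omega>)" "sets (quenched_law \<omega>) = sets path_space"
    if "\<omega> \<in> space (env_law \<mu>)" for \<omega>
    using prob_space_quenched_law sets_quenched_law space_env[OF that] by blast+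
  ultimately show ?thesis
    by (intro measurable_prob_algebra_generated[of path_space UNIV G]) auto
qed

lemma emeasure_annealed_law:
  assumes "prob_space \<mu>" and \<mu>: "sets \<mu> = sets (step_laws :: (int ^ 'd) measure measure)"
    and "A \<in> sets path_space"
  shows "emeasure (annealed_law \<mu>) A = (\<integral>\<^sup>+\<omega>. emeasure (quenched_law \<omega>) A \<partial>env_law \<mu>)"
proof -
  have "prob_space (env_law \<mu>)"
    unfolding env_law_def using assms(1) by (intro prob_space_PiM)
  then show ?thesis
    unfolding annealed_law_def
    using measurable_prob_algebraD[OF measurable_quenched_law[OF \<mu>]] assms(3)
    by (intro emeasure_bind prob_space.not_empty)
qed

end

theory Submission
  imports Defs
begin

text \<open>
  If \<open>V\<close> exists, then almost surely every site allows a step in \<open>V\<close>, and each such step raises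
  \<open>x \<mapsto> \<Sum>v\<in>V. v \<cdot> x\<close> by one because \<open>V\<close> is orthonormal. A sufficiently long run of such steps
  leaves a given finite set, and its probability is bounded below on the set, so the walk is
  confined to the set with probability zero.

  If no \<open>V\<close> exists, then for each choice \<open>s\<close> of signs the orthogonal set of the vectors opposite
  to \<open>s\<^sub>j e\<^sub>j\<close> is missed by \<open>\<G>\<^sub>o\<close> with positive probability, so that only the steps \<open>s\<^sub>j e\<^sub>j\<close> are
  allowed. With positive probability \<open>p\<close>, all corners of a given unit cube therefore allow only the
  steps to other corners, and the cube is a trap. When the walk first leaves the box of radius
  \<open>n\<close>, it stands on a corner of a cube that lies outside this box and inside the box of radius
  \<open>n + 2\<close>. The environment on that cube is independent of the path so far, so the annealed
  probability of leaving the larger box is at most \<open>1 - p\<close> times that of leaving the smaller one.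
\<close>

section \<open>Paths and prefixes\<close>

lemma space_path_space [simp]: "space path_space = UNIV"
  by (simp add: path_space_def space_PiM)

lemma measurable_path_component [measurable]:
  "(\<lambda>X. X i) \<in> path_space \<rightarrow>\<^sub>M count_space UNIV"
  unfolding path_space_def by (rule measurable_component_singleton) simp

text \<open>Finite histories are lists because lists over the lattice form a countable type: almost
  sure statements and sums may then range over all histories.\<close>

definition prefix_event :: "(int ^ 'd) list \<Rightarrow> (nat \<Rightarrow> int ^ 'd) set" where
  "prefix_event xs = {X. \<forall>i<length xs. X i = xs ! i}"

lemma sets_prefix_event: "prefix_event xs \<in> sets path_space"
proof -
  have "{X \<in> space path_space. \<forall>i<length xs. X i = xs ! i} \<in> sets path_space"
    by measurable
  then show ?thesis by (simp add: prefix_event_def)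
qed

lemma mem_prefix_event: "X \<in> prefix_event (map X [0..<n])"
  by (simp add: prefix_event_def)

lemma prefix_event_unique:
  assumes "X \<in> prefix_event xs" "X \<in> prefix_event ys" "length xs = length ys"
  shows "xs = ys"
proof (rule nth_equalityI)
  fix i assume "i < length xs"
  then have "X i = xs ! i" "X i = ys ! i"
    using assms by (auto simp: prefix_event_def)
  then show "xs ! i = ys ! i"
    by simp
qed fact

text \<open>Summing over the countably many disjoint pieces of \<open>A\<close> turns a bound on the
  conditional probability given the history into an unconditional one. \<open>R\<close> will consist
  first of histories of a fixed length, later of histories stopped at a first exit.\<close>

lemma emeasure_le_prefixwise:
  fixes M :: "(nat \<Rightarrow> int ^ 'd) measure"
  assumes M: "sets M = sets path_space"
    and disj: "disjoint_family_on prefix_event R"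
    and A: "A \<in> sets path_space" "A \<subseteq> (\<Union>xs\<in>R. prefix_event xs)"
    and le: "\<And>xs. xs \<in> R \<Longrightarrow> emeasure M (A \<inter> prefix_event xs) \<le> c * emeasure M (prefix_event xs)"
  shows "emeasure M A \<le> c * emeasure M (\<Union>xs\<in>R. prefix_event xs)"
proof -
  have "A = (\<Union>xs\<in>R. A \<inter> prefix_event xs)"
    using A(2) by auto
  then have "emeasure M A = emeasure M (\<Union>xs\<in>R. A \<inter> prefix_event xs)"
    by simp
  also have "\<dots> = (\<integral>\<^sup>+xs. emeasure M (A \<inter> prefix_event xs) \<partial>count_space R)"
    using disj A(1) sets_prefix_event
    by (intro emeasure_UN_countable) (auto simp: M disjoint_family_on_def intro!: sets.Int)
  also have "\<dots> \<le> (\<integral>\<^sup>+xs. c * emeasure M (prefix_event xs) \<partial>count_space R)"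
    using le by (intro nn_integral_mono) simp
  also have "\<dots> = c * (\<integral>\<^sup>+xs. emeasure M (prefix_event xs) \<partial>count_space R)"
    by (intro nn_integral_cmult) simp
  also have "(\<integral>\<^sup>+xs. emeasure M (prefix_event xs) \<partial>count_space R) =
      emeasure M (\<Union>xs\<in>R. prefix_event xs)"
    using disj sets_prefix_event
    by (intro emeasure_UN_countable[symmetric]) (auto simp: M)
  finally show ?thesis .
qed

text \<open>The intersection lies in every \<open>B n\<close>, whose mass is at most
  \<open>c ^ n\<close> by induction; the events themselves need not decrease.\<close>

lemma (in prob_space) emeasure_Inter_eq_0_geometric:
  assumes B: "\<And>n. B n \<in> events"
    and le: "\<And>n. emeasure M (B (Suc n)) \<le> ennreal c * emeasure M (B n)"
    and c: "0 \<le> c" "c < 1"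
  shows "emeasure M (\<Inter>n. B n) = 0"
proof -
  have bound: "emeasure M (B n) \<le> ennreal (c ^ n)" for n
  proof (induction n)
    case (Suc n)
    have "emeasure M (B (Suc n)) \<le> ennreal c * ennreal (c ^ n)"
      using le[of n] Suc by (meson mult_left_mono order_trans zero_le)
    then show ?case
      using c by (simp add: ennreal_mult)
  qed (simp add: emeasure_le_1)
  have "prob (\<Inter>n. B n) \<le> c ^ n" for n
  proof -
    have "emeasure M (\<Inter>n. B n) \<le> emeasure M (B n)"
      using B by (intro emeasure_mono) auto
    then show ?thesis
      using bound[of n] c by (auto simp: emeasure_eq_measure dest: order_trans)
  qed
  moreover have "(\<lambda>n. c ^ n) \<longlonglongrightarrow> 0"
    using c by (intro LIMSEQ_realpow_zero) auto
  ultimately have "prob (\<Inter>n. B n) \<le> 0"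
    by (intro LIMSEQ_le_const[of "\<lambda>n. c ^ n"]) auto
  then show ?thesis
    by (simp add: emeasure_eq_measure measure_le_0_iff)
qed


section \<open>Allowed steps\<close>

lemma finite_unit_vectors: "finite unit_vectors"
  by (simp add: unit_vectors_def)

text \<open>Outside \<open>unit_vectors\<close> the singleton is not measurable, and the default
  value 0 of \<open>emeasure\<close> agrees with \<open>allowed_steps\<close> containing unit
  vectors only.\<close>

lemma emeasure_step_eq_0_iff:
  assumes "p \<in> space step_laws"
  shows "emeasure p {e} = 0 \<longleftrightarrow> e \<notin> allowed_steps p"
proof -
  interpret prob_space p
    using assms by (simp add: space_step_laws)
  have "sets p = Pow unit_vectors"
    using assms by (simp add: space_step_laws)
  then show ?thesis
    by (cases "e \<in> unit_vectors")
      (auto simp: allowed_steps_def measure_notin_sets emeasure_eq_measure zero_less_measure_iff)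
qed

lemma emeasure_quenched_law_prefix_event:
  assumes "\<And>x. \<omega> x \<in> space step_laws" and "xs \<noteq> []"
  shows "emeasure (quenched_law \<omega>) (prefix_event xs) =
    (if hd xs = 0
     then \<Prod>i<length xs - 1. emeasure (\<omega> (xs ! i)) {xs ! Suc i - xs ! i} else 0)"
proof -
  have "prefix_event xs = {X. \<forall>i\<le>length xs - 1. X i = xs ! i}"
    using assms(2) by (cases xs) (simp_all add: prefix_event_def less_Suc_eq_le)
  then show ?thesis
    using emeasure_quenched_law_cylinder[OF assms(1), where n = "length xs - 1" and x = "\<lambda>i. xs ! i"] assms(2)
    by (simp add: hd_conv_nth)
qed

text \<open>A history ending in a forbidden step has a zero factor in its cylinder probability, and
  there are only countably many such histories to discard.\<close>

lemma AE_quenched_law_allowed_steps: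
  fixes \<omega> :: "int ^ 'd \<Rightarrow> (int ^ 'd) measure"
  assumes "\<And>x. \<omega> x \<in> space step_laws"
  shows "AE X in quenched_law \<omega>. \<forall>n. X (Suc n) - X n \<in> allowed_steps (\<omega> (X n))"
proof -
  define bad :: "(int ^ 'd) list set" where
    "bad = {xs. \<exists>n. length xs = Suc (Suc n) \<and> xs ! Suc n - xs ! n \<notin> allowed_steps (\<omega> (xs ! n))}"
  have "AE X in quenched_law \<omega>. \<forall>xs\<in>bad. X \<notin> prefix_event xs"
  proof (subst AE_ball_countable, simp, intro ballI)
    fix xs assume "xs \<in> bad"
    then obtain n where n: "length xs = Suc (Suc n)"
        "xs ! Suc n - xs ! n \<notin> allowed_steps (\<omega> (xs ! n))"
      by (auto simp: bad_def)
    have "emeasure (\<omega> (xs ! n)) {xs ! Suc n - xs ! n} = 0"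
      using n(2) assms emeasure_step_eq_0_iff by blast
    then have "emeasure (quenched_law \<omega>) (prefix_event xs) = 0"
      using n(1) by (subst emeasure_quenched_law_prefix_event[OF assms]) auto
    then show "AE X in quenched_law \<omega>. X \<notin> prefix_event xs"
      using sets_prefix_event by (intro AE_not_in null_setsI) (auto simp: sets_quenched_law[OF assms])
  qed
  then show ?thesis
  proof eventually_elim
    case (elim X)
    show ?case
    proof (rule ccontr)
      assume "\<not> (\<forall>n. X (Suc n) - X n \<in> allowed_steps (\<omega> (X n)))"
      then obtain n where "X (Suc n) - X n \<notin> allowed_steps (\<omega> (X n))"
        by auto
      then have "map X [0..<Suc (Suc n)] \<in> bad"
        by (auto simp: bad_def simp del: upt_Suc)
      then show False
        using elim mem_prefix_event by blast
    qed
  qed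
qed


section \<open>The walk is not confined\<close>

lemma int_dot_add_right: "int_dot u (v + w) = int_dot u v + int_dot u w"
  by (simp add: int_dot_def algebra_simps sum.distrib)

lemma axis_uminus: "axis i (- a) = - axis i (a :: int)"
  by (simp add: axis_def vec_eq_iff)

lemma int_dot_axis: "int_dot (axis i a) (axis j b) = (if i = j then a * b else 0)"
proof -
  have "int_dot (axis i a) (axis j b) = (\<Sum>k\<in>UNIV. if k = i then (if i = j then a * b else 0) else 0)"
    unfolding int_dot_def by (intro sum.cong) (auto simp: axis_def)
  then show ?thesis by simp
qed

lemma int_dot_self_unit_vector:
  assumes "v \<in> unit_vectors"
  shows "int_dot v v = 1"
  using assms by (auto simp: unit_vectors_def int_dot_axis simp flip: axis_uminus)

text \<open>Choosing one allowed vector of \<open>V\<close> at each site gives a deterministic route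
  \<open>T\<close> along which the height \<open>\<phi>\<close> grows by one per step. Whatever the
  history, following \<open>T\<close> for \<open>K\<close> steps leads out of \<open>F\<close> and
  has probability at least \<open>\<epsilon>\<close>.\<close>

lemma AE_quenched_law_leaves_finite:
  fixes \<omega> :: "int ^ 'd \<Rightarrow> (int ^ 'd) measure"
  assumes \<omega>: "\<And>x. \<omega> x \<in> space step_laws"
    and V: "V \<subseteq> unit_vectors" "orthogonal_set V"
    and meets: "\<And>x. allowed_steps (\<omega> x) \<inter> V \<noteq> {}"
    and F: "finite F"
  shows "AE X in quenched_law \<omega>. \<exists>n. X n \<notin> F"
proof (cases "F = {}")
  case False
  interpret prob_space "quenched_law \<omega>"
    by (rule prob_space_quenched_law[OF \<omega>])
  note sets_q [measurable_cong] = sets_quenched_law[OF \<omega>]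
  obtain v where v: "\<And>x. v x \<in> allowed_steps (\<omega> x)" "\<And>x. v x \<in> V"
  proof -
    have "\<forall>x. \<exists>e. e \<in> allowed_steps (\<omega> x) \<and> e \<in> V"
      using meets by blast
    then show ?thesis
      using that by metis
  qed
  define T where "T x = x + v x" for x
  define \<phi> where "\<phi> x = (\<Sum>u\<in>V. int_dot u x)" for x
  have "finite V"
    using V(1) finite_unit_vectors finite_subset by blast
  have \<phi>_v: "\<phi> u = 1" if "u \<in> V" for u
  proof -
    have "\<phi> u = int_dot u u + (\<Sum>w\<in>V - {u}. int_dot w u)"
      unfolding \<phi>_def using \<open>finite V\<close> that by (rule sum.remove)
    also have "(\<Sum>w\<in>V - {u}. int_dot w u) = 0"
      using V(2) that by (intro sum.neutral) (auto simp: orthogonal_set_def)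
    finally show ?thesis
      using int_dot_self_unit_vector that V(1) by auto
  qed
  have \<phi>_T: "\<phi> ((T ^^ k) x) = \<phi> x + int k" for k x
  proof (induction k)
    case (Suc k)
    have "\<phi> (T y) = \<phi> y + 1" for y
      using \<phi>_v[OF v(2)] by (simp add: T_def \<phi>_def int_dot_add_right sum.distrib)
    then show ?case using Suc by simp
  qed simp
  define K where "K = nat (Max (\<phi> ` F) - Min (\<phi> ` F)) + 1"
  have T_out: "(T ^^ K) x \<notin> F" if "x \<in> F" for x
  proof
    assume "(T ^^ K) x \<in> F"
    then have "\<phi> ((T ^^ K) x) \<le> Max (\<phi> ` F)"
      using F by (intro Max_ge) auto
    then have "\<phi> x + int K \<le> Max (\<phi> ` F)"
      by (simp only: \<phi>_T)
    moreover have "Min (\<phi> ` F) \<le> \<phi> x"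
      using F that by simp
    ultimately show False
      by (auto simp: K_def split: if_splits)
  qed
  \<comment> \<open>The quenched probability that the walk, standing at \<open>x\<close>, follows
    \<open>T\<close> for its next \<open>K\<close> steps.\<close>
  define \<delta> where "\<delta> x = (\<Prod>k<K. measure (\<omega> ((T ^^ k) x)) {v ((T ^^ k) x)})" for x
  have \<delta>_pos: "\<delta> x > 0" for x
    unfolding \<delta>_def using v(1) by (intro prod_pos) (auto simp: allowed_steps_def)
  \<comment> \<open>The minimum over the finite set \<open>F\<close> keeps the bound positive; the
    cap at 1 makes \<open>1 - \<epsilon>\<close> nonnegative.\<close>
  define \<epsilon> where "\<epsilon> = min 1 (Min (\<delta> ` F))"
  have \<epsilon>: "0 < \<epsilon>" "\<epsilon> \<le> 1" "\<And>x. x \<in> F \<Longrightarrow> \<epsilon> \<le> \<delta> x"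
    using F False \<delta>_pos by (auto simp: \<epsilon>_def intro: min.coboundedI2)
  define B where "B n = {X. \<forall>i\<le>n. X i \<in> F}" for n :: nat
  have B_sets: "B n \<in> sets path_space" for n
  proof -
    have "{X \<in> space path_space. \<forall>i\<le>n. X i \<in> F} \<in> sets path_space"
      by measurable
    then show ?thesis by (simp add: B_def)
  qed
  have step: "emeasure (quenched_law \<omega>) (B (n + K)) \<le>
      ennreal (1 - \<epsilon>) * emeasure (quenched_law \<omega>) (B n)" for n
  proof -
    define R where "R = {xs. set xs \<subseteq> F \<and> length xs = Suc n}"
    have Un: "(\<Union>xs\<in>R. prefix_event xs) = B n"
    proof (intro antisym subsetI)
      fix X assume "X \<in> B n"
      then have "map X [0..<Suc n] \<in> R"
        by (auto simp: R_def B_def simp del: upt_Suc)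
      then show "X \<in> (\<Union>xs\<in>R. prefix_event xs)"
        using mem_prefix_event by blast
    qed (auto simp: R_def B_def prefix_event_def less_Suc_eq_le subset_eq all_set_conv_all_nth)
    have "emeasure (quenched_law \<omega>) (B (n + K)) \<le>
        ennreal (1 - \<epsilon>) * emeasure (quenched_law \<omega>) (\<Union>xs\<in>R. prefix_event xs)"
    proof (rule emeasure_le_prefixwise)
      show "disjoint_family_on prefix_event R"
        using prefix_event_unique by (force simp: disjoint_family_on_def R_def)
      show "B (n + K) \<subseteq> (\<Union>xs\<in>R. prefix_event xs)"
        unfolding Un by (auto simp: B_def)
      fix xs assume xs: "xs \<in> R"
      then have len: "length xs = Suc n" and last: "xs ! n \<in> F"
        by (auto simp: R_def)
      \<comment> \<open>The history \<open>xs\<close> prolonged by the route \<open>T\<close>. At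
        \<open>i = n\<close> both branches agree, so \<open>y_add\<close> also covers
        \<open>k = 0\<close>.\<close>
      define y where "y i = (if i \<le> n then xs ! i else (T ^^ (i - n)) (xs ! n))" for i
      have y_add: "y (n + k) = (T ^^ k) (xs ! n)" for k
        by (simp add: y_def)
      have pe: "prefix_event xs = {X. \<forall>i\<le>n. X i = y i}"
        by (auto simp: prefix_event_def len y_def)
      have split: "(\<Prod>i<n + k. emeasure (\<omega> (y i)) {y (Suc i) - y i}) =
          (\<Prod>i<n. emeasure (\<omega> (y i)) {y (Suc i) - y i}) *
          (\<Prod>i<k. emeasure (\<omega> ((T ^^ i) (xs ! n))) {v ((T ^^ i) (xs ! n))})" for k
      proof (induction k)
        case (Suc k)
        have "y (Suc (n + k)) - y (n + k) = v ((T ^^ k) (xs ! n))"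
          using y_add[of k] y_add[of "Suc k"] by (simp add: T_def)
        then show ?case
          using Suc y_add[of k] by (simp add: mult.assoc)
      qed simp
      have "emeasure (\<omega> x) {e} = ennreal (measure (\<omega> x) {e})" for x e
        using \<omega>[of x] by (intro finite_measure.emeasure_eq_measure prob_space.finite_measure)
          (simp add: space_step_laws)
      then have "(\<Prod>i<K. emeasure (\<omega> ((T ^^ i) (xs ! n))) {v ((T ^^ i) (xs ! n))}) =
          ennreal (\<delta> (xs ! n))"
        by (simp add: \<delta>_def prod_ennreal)
      then have ext: "emeasure (quenched_law \<omega>) {X. \<forall>i\<le>n + K. X i = y i} =
          emeasure (quenched_law \<omega>) (prefix_event xs) * ennreal (\<delta> (xs ! n))"
        unfolding pe using split[of K] by (simp add: emeasure_quenched_law_cylinder[OF \<omega>])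
      let ?E = "{X. \<forall>i\<le>n + K. X i = y i}"
      have E: "?E \<in> sets path_space"
      proof -
        have "{X \<in> space path_space. \<forall>i\<le>n + K. X i = y i} \<in> sets path_space"
          by measurable
        then show ?thesis by simp
      qed
      have "prob ?E = prob (prefix_event xs) * \<delta> (xs ! n)"
        using ext \<delta>_pos[of "xs ! n"] by (simp add: emeasure_eq_measure flip: ennreal_mult)
      moreover have "prob (prefix_event xs - ?E) = prob (prefix_event xs) - prob ?E"
      proof (rule finite_measure_Diff)
        show "?E \<subseteq> prefix_event xs"
          by (auto simp: pe)
      qed (use sets_prefix_event E in \<open>simp_all add: sets_q\<close>)
      \<comment> \<open>The prolonged path \<open>y\<close> is outside \<open>F\<close> at time
        \<open>n + K\<close>, so a walk still confined to \<open>F\<close> cannot have followed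
        it.\<close>
      moreover have "prob (B (n + K) \<inter> prefix_event xs) \<le> prob (prefix_event xs - ?E)"
      proof (rule finite_measure_mono)
        show "prefix_event xs - ?E \<in> events"
          using sets_prefix_event E by (auto simp: sets_q)
        have "X \<notin> ?E" if "X \<in> B (n + K)" for X
        proof -
          have "X (n + K) \<in> F"
            using that by (simp add: B_def)
          then have "X (n + K) \<noteq> y (n + K)"
            using T_out[OF last] y_add[of K] by auto
          then show ?thesis by blast
        qed
        then show "B (n + K) \<inter> prefix_event xs \<subseteq> prefix_event xs - ?E"
          by auto
      qed
      moreover have "prob (prefix_event xs) * \<epsilon> \<le> prob (prefix_event xs) * \<delta> (xs ! n)"
        using \<epsilon>(3)[OF last] by (intro mult_left_mono) auto
      ultimately have "prob (B (n + K) \<inter> prefix_event xs) \<le> (1 - \<epsilon>) * prob (prefix_event xs)"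
        by (simp add: algebra_simps)
      then show "emeasure (quenched_law \<omega>) (B (n + K) \<inter> prefix_event xs) \<le>
          ennreal (1 - \<epsilon>) * emeasure (quenched_law \<omega>) (prefix_event xs)"
        using \<epsilon> by (simp add: emeasure_eq_measure ennreal_leI flip: ennreal_mult)
    qed (auto simp: sets_q B_sets)
    then show ?thesis by (simp add: Un)
  qed
  \<comment> \<open>One factor \<open>1 - \<epsilon>\<close> is gained per block of \<open>K\<close>
    steps, hence the decay along multiples of \<open>K\<close>.\<close>
  have "emeasure (quenched_law \<omega>) (\<Inter>n. B (n * K)) = 0"
    using step[of "_ * K"] \<epsilon> B_sets
    by (intro emeasure_Inter_eq_0_geometric[where c = "1 - \<epsilon>"]) (auto simp: sets_q add.commute)
  moreover have "{X. \<forall>n. X n \<in> F} \<subseteq> (\<Inter>n. B (n * K))"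
    by (auto simp: B_def)
  ultimately show ?thesis
    using B_sets by (intro AE_I[where N = "\<Inter>n. B (n * K)"]) (auto simp: sets_q)
qed simp


section \<open>Fresh sites carry independent traps\<close>

text \<open>
  The corner \<open>s\<close> of the unit cube with lowest corner \<open>z\<close>, where \<open>s j\<close> says that the
  \<open>j\<close>-th coordinate is the lower one, and the steps leading from it to the other corners.
\<close>
definition corner :: "int ^ 'd \<Rightarrow> ('d \<Rightarrow> bool) \<Rightarrow> int ^ 'd" where
  "corner z s = (\<chi> j. z $ j + (if s j then 0 else 1))"

definition inward :: "('d \<Rightarrow> bool) \<Rightarrow> (int ^ 'd) set" where
  "inward s = range (\<lambda>j. axis j (if s j then 1 else - 1))"

definition trap :: "int ^ 'd \<Rightarrow> (int ^ 'd \<Rightarrow> (int ^ 'd) measure) \<Rightarrow> bool" where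
  "trap z \<omega> \<longleftrightarrow> (\<forall>s. allowed_steps (\<omega> (corner z s)) \<subseteq> inward s)"

lemma inj_corner: "inj (corner z)"
proof (rule injI, rule ext)
  fix s t j assume "corner z s = corner z t"
  then have "corner z s $ j = corner z t $ j"
    by simp
  then show "s j = t j"
    by (simp add: corner_def split: if_splits)
qed

text \<open>An inward step along axis \<open>j\<close> crosses an edge of the cube and only flips
  the \<open>j\<close>-th entry of \<open>s\<close>.\<close>

lemma corner_add_inward:
  assumes "e \<in> inward s"
  shows "corner z s + e \<in> range (corner z)"
proof -
  obtain j where "e = axis j (if s j then 1 else - 1)"
    using assms by (auto simp: inward_def)
  then have "corner z s + e = corner z (s(j := \<not> s j))"
    unfolding vec_eq_iff by (simp add: corner_def axis_def)
  then show ?thesis by simp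
qed

lemma trapped:
  assumes "trap z \<omega>" and "X m \<in> range (corner z)"
    and allowed: "\<And>n. X (Suc n) - X n \<in> allowed_steps (\<omega> (X n))"
  shows "X (m + k) \<in> range (corner z)"
proof (induction k)
  case (Suc k)
  then obtain s where s: "X (m + k) = corner z s"
    by auto
  then have "X (Suc (m + k)) - X (m + k) \<in> inward s"
    using assms(1) allowed[of "m + k"] by (auto simp: trap_def)
  then show ?case
    using corner_add_inward[of "X (Suc (m + k)) - X (m + k)" s z] s by simp
qed (use assms(2) in simp)

lemma inward_subset: "inward s \<subseteq> unit_vectors"
proof
  fix e assume "e \<in> inward s"
  then obtain j where "e = axis j (if s j then 1 else - 1)"
    by (auto simp: inward_def)
  then show "e \<in> unit_vectors"
    by (cases "s j") (auto simp: unit_vectors_def axis_uminus)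
qed

text \<open>The pattern \<open>s\<close> selects one vector on each axis, so distinct members lie on
  distinct axes. With all signs reversed, \<open>inward\<close> supplies the candidate for
  \<open>V\<close> in \<open>trap_prob_bounds\<close>.\<close>

lemma orthogonal_inward: "orthogonal_set (inward s)"
  unfolding orthogonal_set_def
proof (intro ballI impI)
  fix u v assume "u \<in> inward s" "v \<in> inward s" "u \<noteq> v"
  then obtain i j where "u = axis i (if s i then 1 else - 1)" "v = axis j (if s j then 1 else - 1)"
    by (auto simp: inward_def)
  with \<open>u \<noteq> v\<close> show "int_dot u v = 0"
    by (auto simp: int_dot_axis)
qed

section \<open>Measurability and independence of the site laws\<close>

lemma measurable_emeasure_step:
  assumes \<mu>: "sets \<mu> = sets (step_laws :: (int ^ 'd) measure measure)"
  shows "(\<lambda>p. emeasure p {e :: int ^ 'd}) \<in> borel_measurable \<mu>"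
proof (cases "e \<in> unit_vectors")
  case True
  have "(\<lambda>p. emeasure p {e}) \<in> borel_measurable step_laws"
    using True by (auto simp: step_laws_def prob_algebra_def
        intro!: measurable_restrict_space1 measurable_emeasure_subprob_algebra)
  then show ?thesis
    by (simp cong: measurable_cong_sets add: \<mu>)
next
  case False
  have "emeasure p {e} = 0" if "p \<in> space \<mu>" for p
    using that sets_eq_imp_space_eq[OF \<mu>] False
    by (intro emeasure_notin_sets) (auto simp: space_step_laws)
  then show ?thesis
    by (simp cong: measurable_cong)
qed

text \<open>The inclusion says that every vector outside \<open>S\<close> has mass zero, a countable
  conjunction of measurable conditions.\<close>

lemma pred_allowed_steps_subset:
  assumes \<mu>: "sets \<mu> = sets (step_laws :: (int ^ 'd) measure measure)"
  shows "Measurable.pred \<mu> (\<lambda>p. allowed_steps p \<subseteq> (S :: (int ^ 'd) set))"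
proof -
  note [measurable] = measurable_emeasure_step[OF \<mu>]
  have "Measurable.pred \<mu> (\<lambda>p. \<forall>e\<in>- S. emeasure p {e} = 0)"
    by measurable
  moreover have "(\<forall>e\<in>- S. emeasure p {e} = 0) \<longleftrightarrow> allowed_steps p \<subseteq> S" if "p \<in> space \<mu>" for p
    using that sets_eq_imp_space_eq[OF \<mu>] emeasure_step_eq_0_iff[of p] by auto
  ultimately show ?thesis
    by (simp cong: measurable_cong)
qed

text \<open>The coordinates are independent with law \<open>\<mu>\<close> because their joint law is
  the product measure itself. Functions of finitely many of them stay independent, even when the
  index type is infinite, as the lattice is.\<close>

lemma nn_integral_PiM_UNIV_prod:
  fixes f :: "'i \<Rightarrow> 'a \<Rightarrow> ennreal"
  assumes "prob_space \<mu>" and "finite J" and f: "\<And>y. y \<in> J \<Longrightarrow> f y \<in> borel_measurable \<mu>"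
  shows "(\<integral>\<^sup>+\<omega>. (\<Prod>y\<in>J. f y (\<omega> y)) \<partial>PiM UNIV (\<lambda>_. \<mu>)) = (\<Prod>y\<in>J. \<integral>\<^sup>+p. f y p \<partial>\<mu>)"
proof -
  interpret prob_space "PiM UNIV (\<lambda>_::'i. \<mu>)"
    using assms(1) by (intro prob_space_PiM)
  have component: "distr (PiM UNIV (\<lambda>_. \<mu>)) \<mu> (\<lambda>\<omega>. \<omega> y) = \<mu>" for y :: 'i
    using assms(1) by (intro distr_PiM_component) auto
  have "indep_vars (\<lambda>_. \<mu>) (\<lambda>y \<omega>. \<omega> y) (UNIV :: 'i set)"
    by (subst indep_vars_iff_distr_eq_PiM') (auto simp: component restrict_UNIV distr_id)
  then have "indep_vars (\<lambda>_. \<mu>) (\<lambda>y \<omega>. \<omega> y) J"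
    by (rule indep_vars_subset) simp
  then have "indep_vars (\<lambda>_. borel) (\<lambda>y \<omega>. f y (\<omega> y)) J"
    by (rule indep_vars_compose2) (rule f)
  then have "(\<integral>\<^sup>+\<omega>. (\<Prod>y\<in>J. f y (\<omega> y)) \<partial>PiM UNIV (\<lambda>_. \<mu>)) =
      (\<Prod>y\<in>J. \<integral>\<^sup>+\<omega>. f y (\<omega> y) \<partial>PiM UNIV (\<lambda>_. \<mu>))"
    using assms(2) by (intro indep_vars_nn_integral) auto
  also have "\<dots> = (\<Prod>y\<in>J. \<integral>\<^sup>+p. f y p \<partial>\<mu>)"
  proof (intro prod.cong refl)
    fix y assume y: "y \<in> J"
    have "(\<integral>\<^sup>+p. f y p \<partial>\<mu>) = (\<integral>\<^sup>+p. f y p \<partial>distr (PiM UNIV (\<lambda>_. \<mu>)) \<mu> (\<lambda>\<omega>. \<omega> y))"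
      by (simp add: component)
    also have "\<dots> = (\<integral>\<^sup>+\<omega>. f y (\<omega> y) \<partial>PiM UNIV (\<lambda>_. \<mu>))"
      using f[OF y] by (intro nn_integral_distr) auto
    finally show "(\<integral>\<^sup>+\<omega>. f y (\<omega> y) \<partial>PiM UNIV (\<lambda>_. \<mu>)) = (\<integral>\<^sup>+p. f y p \<partial>\<mu>)" ..
  qed
  finally show ?thesis .
qed

text \<open>Cancelling \<open>W * ennreal p\<close> requires finiteness; \<open>W \<le> 1\<close>
  provides it and the equation is solved over the reals.\<close>

lemma ennreal_eq_complement:
  fixes W R :: ennreal
  assumes split: "W = W * ennreal p + R" and W: "W \<le> 1" and p: "0 \<le> p" "p \<le> 1"
  shows "R = ennreal (1 - p) * W"
proof -
  have "R \<le> W * ennreal p + R"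
    by simp
  also have "\<dots> = W"
    using split by (rule sym)
  finally have "R \<le> W" .
  obtain w where w: "W = ennreal w" "0 \<le> w"
    using W by (cases W) (auto simp: top_unique)
  obtain r where r: "R = ennreal r" "0 \<le> r"
    using \<open>R \<le> W\<close> by (cases R) (auto simp: w top_unique)
  have "ennreal w = ennreal (w * p + r)"
    using split w r p by (simp add: ennreal_mult ennreal_plus)
  then have "w = w * p + r"
    using w r p by (subst (asm) ennreal_inj) auto
  then have "r = (1 - p) * w"
    by (simp add: algebra_simps)
  then show ?thesis
    using w r p by (simp add: ennreal_mult)
qed

text \<open>The corners of a cube are distinct sites, so by independence this is the probability
  that a given cube is a trap, whatever its position.\<close>

definition trap_prob :: "(int ^ 'd) measure measure \<Rightarrow> real" where
  "trap_prob \<mu> = (\<Prod>s\<in>UNIV. measure \<mu> {p \<in> space \<mu>. allowed_steps p \<subseteq> inward s})"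

text \<open>The weight of a prefix reads the environment only at the sites it departs from, which
  are those of \<open>butlast xs\<close>; the last site has not been consulted. The trap event reads
  only the corners, and disjoint sets of sites are independent.\<close>

lemma nn_integral_prefix_trap:
  fixes \<mu> :: "(int ^ 'd) measure measure"
  assumes "prob_space \<mu>" and \<mu>: "sets \<mu> = sets (step_laws :: (int ^ 'd) measure measure)"
    and fresh: "set (butlast xs) \<inter> range (corner z) = {}"
    and ne: "xs \<noteq> []"
  shows "(\<integral>\<^sup>+\<omega>. emeasure (quenched_law \<omega>) (prefix_event xs) * indicator {\<omega>. trap z \<omega>} \<omega> \<partial>env_law \<mu>) =
    (\<integral>\<^sup>+\<omega>. emeasure (quenched_law \<omega>) (prefix_event xs) \<partial>env_law \<mu>) * ennreal (trap_prob \<mu>)"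
proof (cases "hd xs = 0")
  case hd: True
  interpret prob_space \<mu> by fact
  let ?I = "set (butlast xs)" and ?C = "range (corner z)"
  define m where "m = length xs - 1"
  \<comment> \<open>Steps are grouped by the site they leave: a site may be left several times, and
    all these factors share the same site law. Only factors of different sites are
    independent.\<close>
  define f where "f y p = (\<Prod>i\<in>{i \<in> {..<m}. xs ! i = y}. emeasure p {xs ! Suc i - xs ! i})" for y p
  define S where "S s = {p \<in> space \<mu>. allowed_steps p \<subseteq> inward s}" for s :: "'d \<Rightarrow> bool"
  define g where "g y = (indicator (S (inv (corner z) y)) :: _ \<Rightarrow> ennreal)" for y
  define h where "h y = (if y \<in> ?I then f y else g y)" for y
  have S: "S s \<in> sets \<mu>" for s
    using pred_allowed_steps_subset[OF \<mu>] by (simp add: S_def pred_def)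
  have f_meas: "f y \<in> borel_measurable \<mu>" for y
    unfolding f_def[abs_def] using measurable_emeasure_step[OF \<mu>] by (intro borel_measurable_prod_ennreal) auto
  have g_meas: "g y \<in> borel_measurable \<mu>" for y
    unfolding g_def using S by simp
  have space_env: "\<omega> x \<in> space step_laws" "\<omega> x \<in> space \<mu>" if "\<omega> \<in> space (env_law \<mu>)" for \<omega> x
    using that sets_eq_imp_space_eq[OF \<mu>] by (auto simp: env_law_def space_PiM PiE_iff)
  have W: "emeasure (quenched_law \<omega>) (prefix_event xs) = (\<Prod>y\<in>?I. f y (\<omega> y))"
    if "\<omega> \<in> space (env_law \<mu>)" for \<omega>
  proof -
    have "(\<lambda>i. xs ! i) ` {..<m} \<subseteq> ?I"
      by (auto simp: m_def nth_butlast[symmetric] intro!: nth_mem)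
    then have "(\<Prod>y\<in>?I. \<Prod>i\<in>{i \<in> {..<m}. xs ! i = y}. emeasure (\<omega> (xs ! i)) {xs ! Suc i - xs ! i}) =
        (\<Prod>i<m. emeasure (\<omega> (xs ! i)) {xs ! Suc i - xs ! i})"
      by (intro prod.group) auto
    moreover have "(\<Prod>y\<in>?I. f y (\<omega> y)) =
        (\<Prod>y\<in>?I. \<Prod>i\<in>{i \<in> {..<m}. xs ! i = y}. emeasure (\<omega> (xs ! i)) {xs ! Suc i - xs ! i})"
      by (simp add: f_def cong: prod.cong_simp)
    ultimately show ?thesis
      using space_env[OF that] hd ne by (simp add: emeasure_quenched_law_prefix_event m_def)
  qed
  \<comment> \<open>The functional \<open>k\<close> is later either evaluation at
    \<open>\<omega>\<close> or integration over \<open>\<mu>\<close>, so one splitting serves both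
    sides of the independence formula.\<close>
  have prod_h: "(\<Prod>y\<in>?I \<union> ?C. k y (h y)) = (\<Prod>y\<in>?I. k y (f y)) * (\<Prod>y\<in>?C. k y (g y))"
    for k :: "_ \<Rightarrow> _ \<Rightarrow> ennreal"
  proof -
    have "(\<Prod>y\<in>?I \<union> ?C. k y (h y)) = (\<Prod>y\<in>?I. k y (h y)) * (\<Prod>y\<in>?C. k y (h y))"
      using fresh by (intro prod.union_disjoint) auto
    moreover have "(\<Prod>y\<in>?C. k y (h y)) = (\<Prod>y\<in>?C. k y (g y))"
      using fresh by (intro prod.cong) (auto simp: h_def)
    moreover have "(\<Prod>y\<in>?I. k y (h y)) = (\<Prod>y\<in>?I. k y (f y))"
      by (intro prod.cong) (auto simp: h_def)
    ultimately show ?thesis by simp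
  qed
  have prod_C: "(\<Prod>y\<in>?C. k y (g y)) = (\<Prod>s\<in>UNIV. k (corner z s) (indicator (S s)))"
    for k :: "_ \<Rightarrow> _ \<Rightarrow> ennreal"
    by (simp add: prod.reindex[OF inj_corner] g_def inv_f_f[OF inj_corner])
  have T: "indicator {\<omega>. trap z \<omega>} \<omega> = (\<Prod>y\<in>?C. g y (\<omega> y))"
    if "\<omega> \<in> space (env_law \<mu>)" for \<omega>
  proof -
    have "(\<Prod>y\<in>?C. g y (\<omega> y)) = (\<Prod>s\<in>UNIV. indicator (S s) (\<omega> (corner z s)))"
      using prod_C[of "\<lambda>y F. F (\<omega> y)"] .
    also have "\<dots> = indicator {\<omega>. trap z \<omega>} \<omega>"
      using space_env(2)[OF that] by (auto simp: indicator_def trap_def S_def prod_zero_iff)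
    finally show ?thesis ..
  qed
  have "(\<integral>\<^sup>+\<omega>. emeasure (quenched_law \<omega>) (prefix_event xs) * indicator {\<omega>. trap z \<omega>} \<omega> \<partial>env_law \<mu>) =
      (\<integral>\<^sup>+\<omega>. (\<Prod>y\<in>?I \<union> ?C. h y (\<omega> y)) \<partial>env_law \<mu>)"
  proof (intro nn_integral_cong)
    fix \<omega> assume "\<omega> \<in> space (env_law \<mu>)"
    then show "emeasure (quenched_law \<omega>) (prefix_event xs) * indicator {\<omega>. trap z \<omega>} \<omega> =
        (\<Prod>y\<in>?I \<union> ?C. h y (\<omega> y))"
      using prod_h[of "\<lambda>y F. F (\<omega> y)"] W T by simp
  qed
  also have "\<dots> = (\<Prod>y\<in>?I \<union> ?C. \<integral>\<^sup>+p. h y p \<partial>\<mu>)"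
    unfolding env_law_def using f_meas g_meas assms(1)
    by (intro nn_integral_PiM_UNIV_prod) (auto simp: h_def)
  also have "\<dots> = (\<Prod>y\<in>?I. \<integral>\<^sup>+p. f y p \<partial>\<mu>) * (\<Prod>y\<in>?C. \<integral>\<^sup>+p. g y p \<partial>\<mu>)"
    by (rule prod_h)
  also have "(\<Prod>y\<in>?I. \<integral>\<^sup>+p. f y p \<partial>\<mu>) =
      (\<integral>\<^sup>+\<omega>. emeasure (quenched_law \<omega>) (prefix_event xs) \<partial>env_law \<mu>)"
    using f_meas assms(1) nn_integral_PiM_UNIV_prod[of \<mu> ?I f, folded env_law_def]
    by (simp add: W cong: nn_integral_cong)
  also have "(\<Prod>y\<in>?C. \<integral>\<^sup>+p. g y p \<partial>\<mu>) = ennreal (trap_prob \<mu>)"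
    using S by (simp add: prod_C[of "\<lambda>_ F. nn_integral \<mu> F"] trap_prob_def emeasure_eq_measure
        prod_ennreal S_def)
  finally show ?thesis .
next
  case False
  have "emeasure (quenched_law \<omega>) (prefix_event xs) = 0" if "\<omega> \<in> space (env_law \<mu>)" for \<omega>
    using False ne that sets_eq_imp_space_eq[OF \<mu>]
    by (subst emeasure_quenched_law_prefix_event) (auto simp: env_law_def space_PiM PiE_iff)
  then show ?thesis
    by (simp cong: nn_integral_cong)
qed


section \<open>Leaving boxes\<close>

definition box_int :: "nat \<Rightarrow> (int ^ 'd) set" where
  "box_int n = {x. \<forall>j. \<bar>x $ j\<bar> \<le> int n}"

lemma finite_box_int: "finite (box_int n :: (int ^ 'd) set)"
proof -
  have "(\<lambda>x. ($) x) ` (box_int n :: (int ^ 'd) set) \<subseteq> (\<Pi>\<^sub>E j\<in>UNIV. {- int n..int n})"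
    by (auto simp: box_int_def abs_le_iff minus_le_iff)
  moreover have "finite (\<Pi>\<^sub>E j\<in>(UNIV :: 'd set). {- int n..int n})"
    by (intro finite_PiE) auto
  moreover have "inj_on (\<lambda>x. ($) x) (box_int n :: (int ^ 'd) set)"
    by (auto intro!: inj_onI simp: vec_eq_iff)
  ultimately show ?thesis
    using finite_imageD finite_subset by blast
qed

text \<open>Some coordinate \<open>i\<close> of \<open>x\<close> exceeds \<open>n\<close> in
  absolute value. The cube extends from \<open>x\<close> away from zero in direction
  \<open>i\<close>: upwards with \<open>x\<close> as lowest corner if \<open>x $ i\<close> is
  positive, downwards with \<open>x\<close> as highest corner otherwise. Other coordinates change by
  at most one, which keeps the cube within radius \<open>n + 2\<close>.\<close>

lemma fresh_cube:
  assumes "x \<in> box_int (Suc n)" "x \<notin> box_int n"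
  obtains z where "x \<in> range (corner z)" "range (corner z) \<inter> box_int n = {}"
    "range (corner z) \<subseteq> box_int (n + 2)"
proof -
  obtain i where i: "\<bar>x $ i\<bar> > int n"
    using assms(2) by (auto simp: box_int_def not_le)
  have bd: "\<bar>x $ j\<bar> \<le> int n + 1" for j
    using assms(1) by (auto simp: box_int_def algebra_simps)
  show ?thesis
  proof (cases "x $ i > 0")
    case True
    show ?thesis
    proof
      have "x = corner x (\<lambda>_. True)"
        by (simp add: corner_def vec_eq_iff)
      then show "x \<in> range (corner x)" by blast
      have "int n < \<bar>corner x s $ i\<bar>" for s
        using i True by (auto simp: corner_def)
      then show "range (corner x) \<inter> box_int n = {}"
        unfolding box_int_def disjoint_iff by (auto simp: not_le intro!: exI[of _ i])
      have "\<bar>corner x s $ j\<bar> \<le> int n + 2" for s j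
        using bd[of j] by (auto simp: corner_def)
      then show "range (corner x) \<subseteq> box_int (n + 2)"
        by (auto simp: box_int_def add.commute)
    qed
  next
    case False
    let ?z = "\<chi> j. x $ j - 1"
    show ?thesis
    proof
      have "x = corner ?z (\<lambda>_. False)"
        by (simp add: corner_def vec_eq_iff)
      then show "x \<in> range (corner ?z)" by blast
      have "int n < \<bar>corner ?z s $ i\<bar>" for s
        using i False by (auto simp: corner_def)
      then show "range (corner ?z) \<inter> box_int n = {}"
        unfolding box_int_def disjoint_iff by (auto simp: not_le intro!: exI[of _ i])
      have "\<bar>corner ?z s $ j\<bar> \<le> int n + 2" for s j
        using bd[of j] by (auto simp: corner_def)
      then show "range (corner ?z) \<subseteq> box_int (n + 2)"
        by (auto simp: box_int_def add.commute)
    qed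
  qed
qed

lemma box_int_mono: "m \<le> n \<Longrightarrow> box_int m \<subseteq> box_int n"
  by (auto simp: box_int_def intro: order_trans)

lemma box_int_add_unit_vector:
  assumes "x \<in> box_int n" "e \<in> unit_vectors"
  shows "x + e \<in> box_int (Suc n)"
proof -
  have "\<bar>(x + e) $ j\<bar> \<le> int n + 1" for j
  proof -
    have "\<bar>e $ j\<bar> \<le> 1"
      using assms(2) by (auto simp: unit_vectors_def axis_def)
    moreover have "\<bar>x $ j\<bar> \<le> int n"
      using assms(1) by (simp add: box_int_def)
    ultimately show ?thesis
      by simp
  qed
  then show ?thesis
    by (simp add: box_int_def add.commute)
qed

section \<open>First exits from a box\<close>

definition leaves_box :: "nat \<Rightarrow> (nat \<Rightarrow> int ^ 'd) set" where
  "leaves_box n = {X. \<exists>i. X i \<notin> box_int n}"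

lemma sets_leaves_box: "leaves_box n \<in> sets path_space"
proof -
  have "{X \<in> space path_space. \<exists>i. X i \<notin> box_int n} \<in> sets path_space"
    by measurable
  then show ?thesis by (simp add: leaves_box_def)
qed

text \<open>These lists stand for the path stopped at its first exit. The exit site is the one entry
  outside \<open>butlast\<close>, so its environment is still unexplored.\<close>

definition exit_prefixes :: "nat \<Rightarrow> (int ^ 'd) list set" where
  "exit_prefixes n = {xs. xs \<noteq> [] \<and> set (butlast xs) \<subseteq> box_int n \<and> last xs \<notin> box_int n}"

lemma exit_prefixes_altdef:
  "xs \<in> exit_prefixes n \<longleftrightarrow>
     (\<exists>k. length xs = Suc k \<and> (\<forall>i<k. xs ! i \<in> box_int n) \<and> xs ! k \<notin> box_int n)"
proof (cases xs rule: rev_cases)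
  case (snoc ys y)
  then show ?thesis
    by (auto simp: exit_prefixes_def nth_append subset_eq all_set_conv_all_nth)
qed (simp add: exit_prefixes_def)

lemma Union_exit_prefixes:
  "(\<Union>xs\<in>exit_prefixes n. prefix_event xs) = (leaves_box n :: (nat \<Rightarrow> int ^ 'd) set)"
proof (rule sym, intro antisym subsetI)
  fix X :: "nat \<Rightarrow> int ^ 'd" assume "X \<in> leaves_box n"
  then obtain i where i: "X i \<notin> box_int n"
    by (auto simp: leaves_box_def)
  define k where "k = (LEAST i. X i \<notin> box_int n)"
  have "X k \<notin> box_int n" "\<forall>i<k. X i \<in> box_int n"
    using LeastI[of "\<lambda>i. X i \<notin> box_int n", OF i] not_less_Least by (auto simp: k_def)
  then have "map X [0..<Suc k] \<in> exit_prefixes n"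
    unfolding exit_prefixes_altdef by (intro exI[of _ k]) (simp del: upt_Suc)
  then show "X \<in> (\<Union>xs\<in>exit_prefixes n. prefix_event xs)"
    using mem_prefix_event by blast
next
  fix X :: "nat \<Rightarrow> int ^ 'd" assume "X \<in> (\<Union>xs\<in>exit_prefixes n. prefix_event xs)"
  then obtain xs k where "\<forall>i<Suc k. X i = xs ! i" "xs ! k \<notin> box_int n"
    by (auto simp: exit_prefixes_altdef prefix_event_def)
  then have "X k \<notin> box_int n"
    by simp
  then show "X \<in> leaves_box n"
    by (auto simp: leaves_box_def)
qed

text \<open>A path has only one first exit time, so two such prefixes of it have equal length and
  therefore coincide.\<close>

lemma disjoint_exit_prefixes: "disjoint_family_on prefix_event (exit_prefixes n)"
proof -
  have "xs = ys" if xs: "xs \<in> exit_prefixes n" and ys: "ys \<in> exit_prefixes n"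
    and X: "X \<in> prefix_event xs" "X \<in> prefix_event ys" for xs ys X
  proof -
    obtain k where k: "length xs = Suc k" "\<forall>i<k. xs ! i \<in> box_int n" "xs ! k \<notin> box_int n"
      using xs by (auto simp: exit_prefixes_altdef)
    obtain l where l: "length ys = Suc l" "\<forall>i<l. ys ! i \<in> box_int n" "ys ! l \<notin> box_int n"
      using ys by (auto simp: exit_prefixes_altdef)
    have eq: "xs ! i = X i" if "i \<le> k" for i
      using X(1) that k(1) by (simp add: prefix_event_def)
    have eq': "ys ! i = X i" if "i \<le> l" for i
      using X(2) that l(1) by (simp add: prefix_event_def)
    have "\<not> k < l" "\<not> l < k"
      using k l eq eq' by (metis less_imp_le order_refl)+
    then show ?thesis
      using k(1) l(1) X by (intro prefix_event_unique) auto
  qed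
  then show ?thesis
    unfolding disjoint_family_on_def by blast
qed

section \<open>Decay of the annealed exit probabilities\<close>

lemma trap_prob_bounds:
  fixes \<mu> :: "(int ^ 'd) measure measure"
  assumes "prob_space \<mu>" and \<mu>: "sets \<mu> = sets (step_laws :: (int ^ 'd) measure measure)"
    and no_V: "\<not> (\<exists>V. V \<noteq> {} \<and> V \<subseteq> unit_vectors \<and> orthogonal_set V \<and>
              measure \<mu> {p \<in> space \<mu>. allowed_steps p \<inter> V \<noteq> {}} = 1)"
  shows "0 < trap_prob \<mu>" "trap_prob \<mu> \<le> 1"
proof -
  interpret prob_space \<mu> by fact
  show "trap_prob \<mu> \<le> 1"
    unfolding trap_prob_def by (intro prod_le_1) (auto simp: prob_le_1)
  show "0 < trap_prob \<mu>"
    unfolding trap_prob_def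
  proof (intro prod_pos ballI)
    fix s :: "'d \<Rightarrow> bool"
    let ?V = "inward (\<lambda>j. \<not> s j)" and ?S = "{p \<in> space \<mu>. allowed_steps p \<subseteq> inward s}"
    \<comment> \<open>\<open>inward s\<close> and \<open>?V\<close> partition the unit vectors, so
      allowing only inward steps is the complement of meeting \<open>?V\<close>. Since
      \<open>?V\<close> is orthogonal and nonempty, \<open>no_V\<close> applies to it.\<close>
    have "e \<in> inward s \<longleftrightarrow> e \<notin> ?V" if unit: "e \<in> unit_vectors" for e
    proof -
      obtain j a where e: "e = axis j a" and a: "a = 1 \<or> a = - 1"
      proof -
        obtain j where "e = axis j 1 \<or> e = axis j (- 1)"
          using unit by (auto simp: unit_vectors_def axis_uminus)
        then show ?thesis
          using that[of j 1] that[of j "- 1"] by blast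
      qed
      have "axis j a \<in> inward t \<longleftrightarrow> a = (if t j then 1 else - 1)" for t
        using a by (auto simp: inward_def axis_eq_axis image_iff)
      then show ?thesis
        using a by (auto simp: e)
    qed
    moreover have "allowed_steps p \<subseteq> unit_vectors" for p :: "(int ^ 'd) measure"
      by (auto simp: allowed_steps_def)
    ultimately have "{p \<in> space \<mu>. allowed_steps p \<inter> ?V \<noteq> {}} = space \<mu> - ?S"
      by blast
    moreover have "?S \<in> events"
      using pred_allowed_steps_subset[OF \<mu>] by (simp add: pred_def)
    moreover have "prob {p \<in> space \<mu>. allowed_steps p \<inter> ?V \<noteq> {}} \<noteq> 1"
    proof -
      have "?V \<noteq> {}"
        by (simp add: inward_def)
      then show ?thesis
        using no_V inward_subset[of "\<lambda>j. \<not> s j"] orthogonal_inward[of "\<lambda>j. \<not> s j"] by blast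
    qed
    ultimately have "prob ?S \<noteq> 0"
      by (simp add: prob_compl)
    then show "0 < prob ?S"
      by (simp add: zero_less_measure_iff)
  qed
qed

lemma annealed_law_prob:
  fixes \<mu> :: "(int ^ 'd) measure measure"
  assumes "prob_space \<mu>" and \<mu>: "sets \<mu> = sets (step_laws :: (int ^ 'd) measure measure)"
  shows "prob_space (annealed_law \<mu>)" "sets (annealed_law \<mu>) = sets path_space"
proof -
  have "prob_space (env_law \<mu>)"
    unfolding env_law_def using assms(1) by (intro prob_space_PiM)
  then have "env_law \<mu> \<in> space (prob_algebra (env_law \<mu>))"
    by (simp add: space_prob_algebra)
  note M = this measurable_quenched_law[OF \<mu>]
  show "prob_space (annealed_law \<mu>)"
    unfolding annealed_law_def using M by (rule prob_space_bind')
  show "sets (annealed_law \<mu>) = sets path_space"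
    unfolding annealed_law_def using M by (rule sets_bind')
qed

text \<open>The estimate is made separately for each first-exit history. The cube is chosen from
  that history alone, so averaging over environments separates the history's weight from the trap
  event.\<close>

lemma emeasure_leaves_box_step:
  fixes \<mu> :: "(int ^ 'd) measure measure"
  assumes "prob_space \<mu>" and \<mu>: "sets \<mu> = sets (step_laws :: (int ^ 'd) measure measure)"
    and trap_prob: "0 < trap_prob \<mu>" "trap_prob \<mu> \<le> 1"
  shows "emeasure (annealed_law \<mu>) (leaves_box (n + 2)) \<le>
    ennreal (1 - trap_prob \<mu>) * emeasure (annealed_law \<mu>) (leaves_box n)"
proof -
  note annealed = emeasure_annealed_law[OF assms(1,2)]
  interpret env: prob_space "env_law \<mu>"
    unfolding env_law_def using assms(1) by (intro prob_space_PiM)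
  note sets_ann = annealed_law_prob(2)[OF assms(1,2)]
  have space_env: "\<omega> x \<in> space step_laws" if "\<omega> \<in> space (env_law \<mu>)" for \<omega> x
    using that sets_eq_imp_space_eq[OF \<mu>] by (auto simp: env_law_def space_PiM PiE_iff)
  have meas: "(\<lambda>\<omega>. emeasure (quenched_law \<omega>) (prefix_event xs)) \<in> borel_measurable (env_law \<mu>)" for xs
    using measurable_prob_algebraD[OF measurable_quenched_law[OF \<mu>]] sets_prefix_event
    by (rule measurable_emeasure_kernel)
  have "emeasure (annealed_law \<mu>) (leaves_box (n + 2)) \<le>
    ennreal (1 - trap_prob \<mu>) * emeasure (annealed_law \<mu>) (\<Union>xs\<in>exit_prefixes n. prefix_event xs)"
  proof (rule emeasure_le_prefixwise[OF sets_ann disjoint_exit_prefixes sets_leaves_box])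
    show "leaves_box (n + 2) \<subseteq> (\<Union>xs\<in>exit_prefixes n. prefix_event xs)"
      using box_int_mono[of n "n + 2"] by (auto simp: Union_exit_prefixes leaves_box_def)
    fix xs :: "(int ^ 'd) list" assume xs: "xs \<in> exit_prefixes n"
    let ?A = "leaves_box (n + 2) \<inter> prefix_event xs"
    have A: "?A \<in> sets path_space"
      using sets_leaves_box sets_prefix_event by (rule sets.Int)
    from xs obtain k where k: "length xs = Suc k" "\<forall>i<k. xs ! i \<in> box_int n" "xs ! k \<notin> box_int n"
      by (auto simp: exit_prefixes_altdef)
    have ne: "xs \<noteq> []" using k by auto
    show "emeasure (annealed_law \<mu>) ?A \<le>
        ennreal (1 - trap_prob \<mu>) * emeasure (annealed_law \<mu>) (prefix_event xs)"
    proof (cases "hd xs = 0 \<and> (\<forall>i<k. xs ! Suc i - xs ! i \<in> unit_vectors)")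
      case True
      \<comment> \<open>The walk starts at the origin, which lies in every box; hence an exit site
        has a predecessor inside the box and lies within radius \<open>n + 1\<close>.\<close>
      have "k \<noteq> 0"
      proof
        assume "k = 0"
        then have "xs ! k = 0"
          using True ne by (simp add: hd_conv_nth)
        then show False
          using k(3) by (simp add: box_int_def)
      qed
      then obtain l where l: "k = Suc l"
        by (cases k) auto
      have "xs ! k \<in> box_int (Suc n)"
        using box_int_add_unit_vector[of "xs ! l" n "xs ! Suc l - xs ! l"] k True l by simp
      then obtain z where z: "xs ! k \<in> range (corner z)" "range (corner z) \<inter> box_int n = {}"
          "range (corner z) \<subseteq> box_int (n + 2)"
        using k(3) by (rule fresh_cube)
      let ?w = "\<lambda>\<omega>. emeasure (quenched_law \<omega>) (prefix_event xs)"
        and ?T = "{\<omega> \<in> space (env_law \<mu>). trap z \<omega>}"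
      have T: "?T \<in> sets (env_law \<mu>)"
      proof -
        have "(\<lambda>\<omega>. \<omega> y) \<in> env_law \<mu> \<rightarrow>\<^sub>M \<mu>" for y
          unfolding env_law_def by simp
        then have "Measurable.pred (env_law \<mu>) (\<lambda>\<omega>. allowed_steps (\<omega> y) \<subseteq> S)" for y S
          using pred_allowed_steps_subset[OF \<mu>] by (rule measurable_compose)
        then have "Measurable.pred (env_law \<mu>) (trap z)"
          unfolding trap_def[abs_def] by (intro pred_intros_countable)
        then show ?thesis
          by (simp add: pred_def)
      qed
      \<comment> \<open>In a trap, the walk almost surely stays in the cube from time
        \<open>k\<close> on, and before \<open>k\<close> it was in the smaller box; so it never
        leaves radius \<open>n + 2\<close>.\<close>
      have escape: "emeasure (quenched_law \<omega>) ?A \<le> ?w \<omega> * indicator (space (env_law \<mu>) - ?T) \<omega>"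
        if \<omega>: "\<omega> \<in> space (env_law \<mu>)" for \<omega>
      proof (cases "trap z \<omega>")
        case True
        have "AE X in quenched_law \<omega>. X \<notin> ?A"
          using AE_quenched_law_allowed_steps[OF space_env[OF \<omega>]]
        proof eventually_elim
          case (elim X)
          show ?case
          proof
            assume X: "X \<in> ?A"
            then obtain i where i: "X i \<notin> box_int (n + 2)"
              by (auto simp: leaves_box_def)
            have pre: "X j = xs ! j" if "j \<le> k" for j
              using X that k(1) by (auto simp: prefix_event_def)
            show False
            proof (cases "i < k")
              case True
              then show False
                using i pre[of i] k(2) box_int_mono[of n "n + 2"] by auto
            next
              case False
              have "X k \<in> range (corner z)"
                using z(1) pre[of k] by simp
              then have "X (k + (i - k)) \<in> range (corner z)"
                using elim by (intro trapped[OF \<open>trap z \<omega>\<close>, where X = X and m = k]) blast+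
              then show False
                using False i z(3) by auto
            qed
          qed
        qed
        then have "emeasure (quenched_law \<omega>) {X \<in> space (quenched_law \<omega>). X \<in> ?A} = 0"
          by (rule emeasure_eq_0_AE)
        moreover have "space (quenched_law \<omega>) = UNIV"
          using sets_eq_imp_space_eq[OF sets_quenched_law[OF space_env[OF \<omega>]]] by simp
        moreover have "{X \<in> UNIV. X \<in> ?A} = ?A"
          by blast
        ultimately have "emeasure (quenched_law \<omega>) ?A = 0"
          by (simp only:)
        then show ?thesis by simp
      next
        case False
        have "emeasure (quenched_law \<omega>) ?A \<le> ?w \<omega>"
          using sets_prefix_event
          by (intro emeasure_mono) (simp_all add: sets_quenched_law[OF space_env[OF \<omega>]])
        then show ?thesis
          using \<omega> False by simp
      qed
      \<comment> \<open>All sites before the exit lie in the box, which the cube avoids.\<close>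
      have "set (butlast xs) \<inter> range (corner z) = {}"
        using xs z(2) by (auto simp: exit_prefixes_def)
      note ind = nn_integral_prefix_trap[OF assms(1,2) this ne]
      let ?W = "\<integral>\<^sup>+\<omega>. ?w \<omega> \<partial>env_law \<mu>"
        and ?R = "\<integral>\<^sup>+\<omega>. ?w \<omega> * indicator (space (env_law \<mu>) - ?T) \<omega> \<partial>env_law \<mu>"
      have "?W = (\<integral>\<^sup>+\<omega>. ?w \<omega> * indicator ?T \<omega> +
          ?w \<omega> * indicator (space (env_law \<mu>) - ?T) \<omega> \<partial>env_law \<mu>)"
        by (intro nn_integral_cong) (auto simp: indicator_def)
      also have "\<dots> = (\<integral>\<^sup>+\<omega>. ?w \<omega> * indicator ?T \<omega> \<partial>env_law \<mu>) + ?R"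
        using meas T by (intro nn_integral_add borel_measurable_times_ennreal
            borel_measurable_indicator sets.compl_sets)
      also have "(\<integral>\<^sup>+\<omega>. ?w \<omega> * indicator ?T \<omega> \<partial>env_law \<mu>) = ?W * ennreal (trap_prob \<mu>)"
        unfolding ind[symmetric] by (intro nn_integral_cong) (auto simp: indicator_def)
      finally have split: "?W = ?W * ennreal (trap_prob \<mu>) + ?R" .
      have "?W \<le> (\<integral>\<^sup>+\<omega>. 1 \<partial>env_law \<mu>)"
        by (intro nn_integral_mono prob_space.emeasure_le_1 prob_space_quenched_law space_env)
      then have "?W \<le> 1"
        by (simp add: env.emeasure_space_1)
      then have "?R = ennreal (1 - trap_prob \<mu>) * ?W"
        using split trap_prob by (intro ennreal_eq_complement) auto
      moreover have "emeasure (annealed_law \<mu>) ?A \<le> ?R"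
        unfolding annealed[OF A] using escape by (rule nn_integral_mono)
      ultimately show ?thesis
        by (simp add: annealed[OF sets_prefix_event])
    \<comment> \<open>Prefixes not starting at the origin or containing a step that is no unit
      vector have probability zero.\<close>
    next
      case False
      have "emeasure (quenched_law \<omega>) (prefix_event xs) = 0" if \<omega>: "\<omega> \<in> space (env_law \<mu>)" for \<omega>
      proof (cases "hd xs = 0")
        case True
        then obtain i where i: "i < k" "xs ! Suc i - xs ! i \<notin> unit_vectors"
          using False by auto
        then have "emeasure (\<omega> (xs ! i)) {xs ! Suc i - xs ! i} = 0"
          by (subst emeasure_step_eq_0_iff[OF space_env[OF \<omega>]]) (auto simp: allowed_steps_def)
        then show ?thesis
          using i k(1) by (subst emeasure_quenched_law_prefix_event[OF space_env[OF \<omega>] ne]) auto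
      qed (simp add: emeasure_quenched_law_prefix_event[OF space_env[OF \<omega>] ne])
      then have "emeasure (annealed_law \<mu>) (prefix_event xs) = 0"
        by (simp add: annealed[OF sets_prefix_event] cong: nn_integral_cong)
      moreover have "emeasure (annealed_law \<mu>) ?A \<le> emeasure (annealed_law \<mu>) (prefix_event xs)"
        using sets_prefix_event by (intro emeasure_mono) (auto simp: sets_ann)
      ultimately show ?thesis by simp
    qed
  qed
  then show ?thesis
    by (simp only: Union_exit_prefixes)
qed

section \<open>The two alternatives under the annealed law\<close>

lemma AE_annealed_law_infinite_range:
  fixes \<mu> :: "(int ^ 'd) measure measure"
  assumes "prob_space \<mu>" and \<mu>: "sets \<mu> = sets (step_laws :: (int ^ 'd) measure measure)"
    and V: "V \<subseteq> unit_vectors" "orthogonal_set V"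
    and meets: "measure \<mu> {p \<in> space \<mu>. allowed_steps p \<inter> V \<noteq> {}} = 1"
  shows "AE X in annealed_law \<mu>. infinite (range X)"
proof -
  interpret prob_space \<mu> by fact
  \<comment> \<open>A nonmeasurable set would get the default measure 0, so measure 1 implies
    measurability.\<close>
  have "{p \<in> space \<mu>. allowed_steps p \<inter> V \<noteq> {}} \<in> events"
    using meets measure_notin_sets by fastforce
  then have ae: "AE p in \<mu>. allowed_steps p \<inter> V \<noteq> {}"
    using meets by (subst (asm) prob_Collect_eq_1) auto
  have "AE \<omega> in env_law \<mu>. allowed_steps (\<omega> x) \<inter> V \<noteq> {}" for x
    unfolding env_law_def using ae assms(1) by (intro AE_PiM_component) auto
  then have "AE \<omega> in env_law \<mu>. \<forall>x. allowed_steps (\<omega> x) \<inter> V \<noteq> {}"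
    by (simp add: AE_all_countable)
  \<comment> \<open>Finite sets are represented by lists: the quantifier becomes countable, so it
    commutes with "almost surely" and gives a measurable event.\<close>
  then have "AE \<omega> in env_law \<mu>. AE X in quenched_law \<omega>. \<forall>xs. \<exists>n. X n \<notin> set xs"
    using AE_space
  proof eventually_elim
    case (elim \<omega>)
    have "\<omega> x \<in> space step_laws" for x
      using elim(2) sets_eq_imp_space_eq[OF \<mu>] by (auto simp: env_law_def space_PiM PiE_iff)
    then show ?case
      using elim(1) V by (subst AE_all_countable) (auto intro!: AE_quenched_law_leaves_finite[of \<omega> V])
  qed
  moreover have "Measurable.pred path_space (\<lambda>X. \<forall>xs. \<exists>n. X n \<notin> set xs)"
    by measurable
  ultimately have "AE X in annealed_law \<mu>. \<forall>xs. \<exists>n. X n \<notin> set xs"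
    unfolding annealed_law_def
    using measurable_prob_algebraD[OF measurable_quenched_law[OF \<mu>]] by (subst AE_bind) auto
  then show ?thesis
  proof eventually_elim
    case (elim X)
    show ?case
    proof
      assume "finite (range X)"
      then obtain xs where "set xs = range X"
        using finite_list by blast
      then show False
        using elim by (metis rangeI)
    qed
  qed
qed

lemma AE_annealed_law_finite_range:
  fixes \<mu> :: "(int ^ 'd) measure measure"
  assumes "prob_space \<mu>" and \<mu>: "sets \<mu> = sets (step_laws :: (int ^ 'd) measure measure)"
    and trap_prob: "0 < trap_prob \<mu>" "trap_prob \<mu> \<le> 1"
  shows "AE X in annealed_law \<mu>. finite (range X)"
proof -
  note ann = annealed_law_prob[OF assms(1,2)]
  \<comment> \<open>Even radii are used because each factor \<open>1 - trap_prob \<mu>\<close> costs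
    an increase of the radius by 2.\<close>
  have "emeasure (annealed_law \<mu>) (\<Inter>n. leaves_box (2 * n)) = 0"
    using trap_prob emeasure_leaves_box_step[OF assms, of "2 * _"] sets_leaves_box
    by (intro prob_space.emeasure_Inter_eq_0_geometric[OF ann(1), where c = "1 - trap_prob \<mu>"])
      (auto simp: ann(2))
  moreover have "X \<in> (\<Inter>n. leaves_box (2 * n))" if "infinite (range X)" for X :: "nat \<Rightarrow> int ^ 'd"
  proof
    fix n
    have "\<not> range X \<subseteq> box_int (2 * n)"
      using that finite_subset[OF _ finite_box_int] by blast
    then show "X \<in> leaves_box (2 * n)"
      by (auto simp: leaves_box_def)
  qed
  ultimately show ?thesis
    using sets_leaves_box by (intro AE_I[where N = "\<Inter>n. leaves_box (2 * n)"]) (auto simp: ann(2))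
qed

theorem theorem1p2:
  fixes \<mu> :: "(int ^ 'd) measure measure"
  assumes "CARD('d) \<ge> 2"
    and "prob_space \<mu>" and "sets \<mu> = sets step_laws"
  shows "((\<exists>V. V \<noteq> {} \<and> V \<subseteq> unit_vectors \<and> orthogonal_set V \<and>
              measure \<mu> {p \<in> space \<mu>. allowed_steps p \<inter> V \<noteq> {}} = 1)
            \<longrightarrow> (AE X in annealed_law \<mu>. infinite (range X))) \<and>
         (\<not> (\<exists>V. V \<noteq> {} \<and> V \<subseteq> unit_vectors \<and> orthogonal_set V \<and>
              measure \<mu> {p \<in> space \<mu>. allowed_steps p \<inter> V \<noteq> {}} = 1)
            \<longrightarrow> (AE X in annealed_law \<mu>. finite (range X)))"
proof (intro conjI impI)
  assume "\<exists>V. V \<noteq> {} \<and> V \<subseteq> unit_vectors \<and> orthogonal_set V \<and>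
      measure \<mu> {p \<in> space \<mu>. allowed_steps p \<inter> V \<noteq> {}} = 1"
  then show "AE X in annealed_law \<mu>. infinite (range X)"
    using AE_annealed_law_infinite_range assms(2,3) by blast
next
  assume "\<not> (\<exists>V. V \<noteq> {} \<and> V \<subseteq> unit_vectors \<and> orthogonal_set V \<and>
      measure \<mu> {p \<in> space \<mu>. allowed_steps p \<inter> V \<noteq> {}} = 1)"
  then show "AE X in annealed_law \<mu>. finite (range X)"
    using AE_annealed_law_finite_range trap_prob_bounds assms(2,3) by blast
qed

end
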